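(* Let $\mathsf{T}:\mathbb{S}^q\to\mathbb{S}^q$ be a rank-indecomposable linear operator such that (1) $|\langle \mathbf{v}\mathbf{v}',\mathsf{T}(\mathbf{u}\mathbf{u}')\rangle-1/q|\le 1/(2q)$ for all unit-norm vectors $\mathbf{u},\mathbf{v}\in\mathbb{R}^q$; and (2) $\epsilon:=\max\{\|\mathsf{T}(I)-I\|_2,\ \|\mathsf{T}'(I)-I\|_2\}\le 1/(48\sqrt q)$. Let $N_1,N_2\in\mathbb{S}^q$ be positive definite matrices such that $(N_2\otimes N_2)\circ\mathsf{T}\circ(N_1\otimes N_1)$ is doubly stochastic. Then $\|N_2^2\otimes N_1^2-\mathsf{I}\|_2\le 96\sqrt q\,\epsilon$. Furthermore, $\|N_2\otimes N_1-\mathsf{I}\|_2\le 96\sqrt q\,\epsilon$.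
   Context: $\mathbb{S}^q$ is the space of real symmetric $q\times q$ matrices with the trace inner product; $\mathsf{T}'$ is the adjoint of $\mathsf{T}$; $\|\cdot\|_2$ is the spectral (operator) norm. The operators considered leave the positive-semidefinite cone invariant. $\mathsf{T}$ is rank-indecomposable if $\mathrm{rank}(\mathsf{T}(Z))>\mathrm{rank}(Z)$ for all $Z\succeq0$ with $1\le\mathrm{rank}(Z)<q$. $N\otimes N$ acts on $\mathbb{S}^q$ by $Z\mapsto NZN$ (for symmetric $N$). A positive-semidefinite-cone-preserving linear operator $\tilde{\mathsf{T}}$ on $\mathbb{S}^q$ is doubly stochastic if $\tilde{\mathsf{T}}(I)=\tilde{\mathsf{T}}'(I)=I$. In the conclusion, $\otimes$ is the Kronecker product, giving operators on $\mathbb{R}^{q\times q}$ (a $q^2$-dimensional space), and $\mathsf{I}$ is the identity on $\mathbb{R}^{q\times q}$. *)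

theory Defs
  imports "HOL-Analysis.Analysis"
begin

definition sym_mats :: "(real^'q^'q) set" where
  "sym_mats = {A. transpose A = A}"

definition psd :: "real^'q^'q \<Rightarrow> bool" where
  "psd A \<longleftrightarrow> A \<in> sym_mats \<and> (\<forall>x. 0 \<le> x \<bullet> (A *v x))"

definition posdef :: "real^'q^'q \<Rightarrow> bool" where
  "posdef A \<longleftrightarrow> A \<in> sym_mats \<and> (\<forall>x. x \<noteq> 0 \<longrightarrow> 0 < x \<bullet> (A *v x))"

definition spectral_norm :: "real^'n^'m \<Rightarrow> real" where
  "spectral_norm A = onorm ((*v) A)"

definition outer_self :: "real^'q \<Rightarrow> real^'q^'q" where
  "outer_self v = (columnvector v :: real^1^'q) ** (rowvector v :: real^'q^1)"

text \<open>
  The library inner product on \<^typ>\<open>real^'q^'q\<close> is the trace inner product.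
\<close>

lemma inner_eq_trace: "A \<bullet> B = trace (transpose A ** B)" for A B :: "real^'q^'q"
  unfolding inner_vec_def trace_def matrix_matrix_mult_def transpose_def
  by (simp, rule sum.swap)

text \<open>
  A linear operator on the space of symmetric matrices is represented by a function on all
  matrices; only its values on \<^const>\<open>sym_mats\<close> are constrained, and only those matter below.
\<close>

definition sym_operator :: "(real^'q^'q \<Rightarrow> real^'q^'q) \<Rightarrow> bool" where
  "sym_operator T \<longleftrightarrow>
     (\<forall>X\<in>sym_mats. T X \<in> sym_mats) \<and>
     (\<forall>X\<in>sym_mats. \<forall>Y\<in>sym_mats. T (X + Y) = T X + T Y) \<and>
     (\<forall>c. \<forall>X\<in>sym_mats. T (c *\<^sub>R X) = c *\<^sub>R T X)"

definition sym_adjoint :: "(real^'q^'q \<Rightarrow> real^'q^'q) \<Rightarrow> real^'q^'q \<Rightarrow> real^'q^'q" where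
  "sym_adjoint T Y = (THE Z. Z \<in> sym_mats \<and> (\<forall>X\<in>sym_mats. T X \<bullet> Y = X \<bullet> Z))"

lemma sym_adjoint_unique_existence:
  fixes T :: "real^'q^'q \<Rightarrow> real^'q^'q"
  assumes T: "sym_operator T"
  shows "\<exists>!Z. Z \<in> sym_mats \<and> (\<forall>X\<in>sym_mats. T X \<bullet> Y = X \<bullet> Z)"
proof (rule ex_ex1I)
  define P :: "real^'q^'q \<Rightarrow> real^'q^'q" where "P X = (1/2) *\<^sub>R (X + transpose X)" for X
  have tr_add: "transpose (A + B) = transpose A + transpose B"
    and tr_scale: "transpose (c *\<^sub>R A) = c *\<^sub>R transpose A" for A B :: "real^'q^'q" and c
    by (simp_all add: transpose_def vec_eq_iff)
  have P_sym: "P X \<in> sym_mats" for X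
    by (simp add: P_def sym_mats_def tr_add tr_scale add.commute)
  have P_id: "P X = X" if "X \<in> sym_mats" for X
    using that by (simp add: P_def sym_mats_def scaleR_2 [symmetric])
  have tr_inner: "transpose A \<bullet> B = A \<bullet> transpose B" for A B :: "real^'q^'q"
    unfolding inner_vec_def transpose_def by (simp, rule sum.swap)
  have P_inner: "P A \<bullet> B = A \<bullet> P B" for A B
    by (simp add: P_def inner_add_left inner_add_right tr_inner)
  have P_add: "P (A + B) = P A + P B" and P_scale: "P (c *\<^sub>R A) = c *\<^sub>R P A" for A B c
    by (simp_all add: P_def tr_add tr_scale algebra_simps)
  have lin: "linear (\<lambda>X. T (P X))"
    using T P_sym by (intro linearI) (auto simp: P_add P_scale sym_operator_def)
  define Z where "Z = P (adjoint (\<lambda>X. T (P X)) Y)"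
  have "T X \<bullet> Y = X \<bullet> Z" if X: "X \<in> sym_mats" for X
  proof -
    have "T X \<bullet> Y = T (P X) \<bullet> Y"
      by (simp add: P_id X)
    also have "\<dots> = X \<bullet> adjoint (\<lambda>X. T (P X)) Y"
      using adjoint_works [OF lin, of X Y] by simp
    also have "\<dots> = X \<bullet> Z"
      by (metis P_id P_inner X Z_def)
    finally show ?thesis .
  qed
  then show "\<exists>Z. Z \<in> sym_mats \<and> (\<forall>X\<in>sym_mats. T X \<bullet> Y = X \<bullet> Z)"
    using P_sym Z_def by blast
next
  fix Z W :: "real^'q^'q"
  assume Z: "Z \<in> sym_mats \<and> (\<forall>X\<in>sym_mats. T X \<bullet> Y = X \<bullet> Z)"
    and W: "W \<in> sym_mats \<and> (\<forall>X\<in>sym_mats. T X \<bullet> Y = X \<bullet> W)"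
  have "Z - W \<in> sym_mats"
    using Z W by (auto simp: sym_mats_def transpose_def vec_eq_iff)
  then have "(Z - W) \<bullet> Z = (Z - W) \<bullet> W"
    using Z W by metis
  then have "(Z - W) \<bullet> (Z - W) = 0"
    by (simp add: inner_diff_right)
  then show "Z = W"
    by simp
qed

definition psd_preserving :: "(real^'q^'q \<Rightarrow> real^'q^'q) \<Rightarrow> bool" where
  "psd_preserving T \<longleftrightarrow> (\<forall>Z. psd Z \<longrightarrow> psd (T Z))"

definition rank_indecomposable :: "(real^'q^'q \<Rightarrow> real^'q^'q) \<Rightarrow> bool" where
  "rank_indecomposable T \<longleftrightarrow>
     (\<forall>Z. psd Z \<and> 1 \<le> rank Z \<and> rank Z < CARD('q) \<longrightarrow> rank (T Z) > rank Z)"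

definition doubly_stochastic :: "(real^'q^'q \<Rightarrow> real^'q^'q) \<Rightarrow> bool" where
  "doubly_stochastic T \<longleftrightarrow>
     sym_operator T \<and> psd_preserving T \<and> T (mat 1) = mat 1 \<and> sym_adjoint T (mat 1) = mat 1"

text \<open>The operator $N \otimes N$ on symmetric matrices, for symmetric $N$.\<close>

definition conj_op :: "real^'q^'q \<Rightarrow> real^'q^'q \<Rightarrow> real^'q^'q" where
  "conj_op N Z = N ** Z ** N"

text \<open>
  The Kronecker product has rows and columns indexed by pairs, so it acts by \<open>*v\<close> on
  \<^typ>\<open>real^('q \<times> 'q)\<close>, the $q \times q$ matrices with the Frobenius norm.
\<close>

definition kronecker :: "real^'n^'m \<Rightarrow> real^'l^'k \<Rightarrow> real^('n \<times> 'l)^('m \<times> 'k)" where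
  "kronecker A B = (\<chi> ik jl. A $ fst ik $ fst jl * B $ snd ik $ snd jl)"

end

theory Submission
  imports Defs
begin

text \<open>
  In orthonormal eigenbases \<open>u\<close> of \<open>N1\<close> and \<open>v\<close> of \<open>N2\<close>, with eigenvalues \<open>l u\<close> and
  \<open>\<mu> v\<close>, the statement becomes one about scaling a nonnegative matrix. Put
  \<open>M v u = \<langle>v v', T (u u')\<rangle>\<close>. Since \<open>mat 1\<close> is the sum of the \<open>u u'\<close>, and also of the \<open>v v'\<close>, the
  row and column sums of \<open>M\<close> are values of the quadratic forms of \<open>T (mat 1)\<close> and of its adjoint
  counterpart, so they are within \<open>\<epsilon>\<close> of 1; and double stochasticity of the scaled operator says
  that the numbers \<open>x v = (\<mu> v)\<^sup>2\<close> and \<open>y u = (l u)\<^sup>2\<close> make \<open>x v * M v u * y u\<close> doubly stochastic.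
  Since the eigenvalues of the Kronecker product of \<open>N2\<^sup>2\<close> and \<open>N1\<^sup>2\<close> are the products \<open>x v * y u\<close>, all
  that has to be shown is that every such product is close to 1.

  For this, every entry of \<open>M\<close> is at least \<open>1 / (2 q)\<close>, so half of the mass of each row is spread
  uniformly and contributes the same amount to every entry of \<open>M y\<close>. Hence passing from \<open>y\<close> to
  \<open>M y\<close>, whose entries are the reciprocals of those of \<open>x\<close>, halves the distance of the ratio
  max/min from 1, up to an error of order \<open>\<epsilon>\<close> from the row sums (\<open>reciprocal_image_ratio\<close>). The
  same holds from \<open>x\<close> back to \<open>y\<close>, and playing the two estimates against each other bounds both
  ratios by \<open>1 / (1 - 4 \<epsilon>)\<close> (\<open>scaling_ratio_bound\<close>). So \<open>y\<close> is almost constant, and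
  \<open>x v * (\<Sum>u. M v u * y u) = 1\<close> with row sum almost 1 forces \<open>\<bar>x v * y u - 1\<bar> \<le> 6 \<epsilon>\<close>
  (\<open>scaling_products_near_one\<close>). This constant is free of the dimension, and
  \<open>6 \<le> 96 * sqrt q\<close>. The unsquared bound follows because a positive number is at least as close
  to 1 as its square is.

  The eigenbases come from the spectral theorem, proved here by maximising the quadratic form.
\<close>

section \<open>Scaling a nearly doubly stochastic matrix\<close>

text \<open>
  The uniform part \<open>a\<close> of the weights, of total mass 1/2, is kept exact; only the remaining weights
  \<open>m j - a\<close>, of total mass within \<open>\<epsilon>\<close> of 1/2, are estimated by the extreme values of \<open>y\<close>.
\<close>

lemma weighted_sum_bounds:
  fixes m y :: "'a \<Rightarrow> real" and a :: real
  assumes J: "finite J"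
    and a: "a * card J = 1/2" "\<And>j. j \<in> J \<Longrightarrow> a \<le> m j"
    and m: "\<bar>(\<Sum>j\<in>J. m j) - 1\<bar> \<le> \<epsilon>"
    and y: "\<And>j. j \<in> J \<Longrightarrow> p \<le> y j" "\<And>j. j \<in> J \<Longrightarrow> y j \<le> t" and p: "0 < p" and t: "p \<le> t"
  shows "a * (\<Sum>j\<in>J. y j) + (1/2 - \<epsilon>) * p \<le> (\<Sum>j\<in>J. m j * y j)"
    and "(\<Sum>j\<in>J. m j * y j) \<le> a * (\<Sum>j\<in>J. y j) + (1/2 + \<epsilon>) * t"
proof -
  have split: "(\<Sum>j\<in>J. m j * y j) = a * (\<Sum>j\<in>J. y j) + (\<Sum>j\<in>J. (m j - a) * y j)"
    by (simp add: sum_distrib_left left_diff_distrib sum_subtractf)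
  have rest: "(\<Sum>j\<in>J. (m j - a) * c) = ((\<Sum>j\<in>J. m j) - 1/2) * c" for c
    unfolding sum_distrib_right [symmetric] using a(1) by (simp add: sum_subtractf mult.commute)
  have "(1/2 - \<epsilon>) * p \<le> ((\<Sum>j\<in>J. m j) - 1/2) * p"
    using m p by (intro mult_right_mono) auto
  also have "\<dots> \<le> (\<Sum>j\<in>J. (m j - a) * y j)"
    unfolding rest [symmetric] using a y by (intro sum_mono mult_left_mono) auto
  finally show "a * (\<Sum>j\<in>J. y j) + (1/2 - \<epsilon>) * p \<le> (\<Sum>j\<in>J. m j * y j)"
    using split by simp
  have "(\<Sum>j\<in>J. (m j - a) * y j) \<le> ((\<Sum>j\<in>J. m j) - 1/2) * t"
    unfolding rest [symmetric] using a y by (intro sum_mono mult_left_mono) auto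
  also have "\<dots> \<le> (1/2 + \<epsilon>) * t"
    using m p t by (intro mult_right_mono) auto
  finally show "(\<Sum>j\<in>J. m j * y j) \<le> a * (\<Sum>j\<in>J. y j) + (1/2 + \<epsilon>) * t"
    using split by simp
qed

text \<open>
  Two weighted sums share the uniform part \<open>S\<close> and differ only in the other half of the mass, so
  their ratio is at most about \<open>(1 + \<tau>) / 2\<close> when the ratio of the values is at most \<open>\<tau>\<close>. The worst case
  is \<open>S = p / 2\<close>, where all uniformly weighted values are minimal, and this gives the constants.
\<close>

lemma weighted_sums_ratio:
  fixes m n y :: "'a \<Rightarrow> real" and a :: real
  assumes J: "finite J"
    and a: "a * card J = 1/2" "\<And>j. j \<in> J \<Longrightarrow> a \<le> m j" "\<And>j. j \<in> J \<Longrightarrow> a \<le> n j"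
    and m: "\<bar>(\<Sum>j\<in>J. m j) - 1\<bar> \<le> \<epsilon>" and n: "\<bar>(\<Sum>j\<in>J. n j) - 1\<bar> \<le> \<epsilon>"
    and y: "\<And>j. j \<in> J \<Longrightarrow> p \<le> y j" "\<And>j. j \<in> J \<Longrightarrow> y j \<le> \<tau> * p" and p: "0 < p"
    and tau: "1 \<le> \<tau>" and eps: "\<epsilon> \<le> 1/2"
  shows "(1 - \<epsilon>) * (\<Sum>j\<in>J. m j * y j) \<le> (1/2 + (1/2 + \<epsilon>) * \<tau>) * (\<Sum>j\<in>J. n j * y j)"
proof -
  define S where "S = a * (\<Sum>j\<in>J. y j)"
  have eps0: "0 \<le> \<epsilon>" using m by linarith
  have a0: "0 \<le> a"
  proof (rule ccontr)
    assume "\<not> 0 \<le> a"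
    then have "a * card J \<le> 0" by (intro mult_nonpos_nonneg) auto
    with a(1) show False by simp
  qed
  have "a * (\<Sum>j\<in>J. p) \<le> S"
    unfolding S_def using y a0 by (intro mult_left_mono sum_mono)
  then have S: "p / 2 \<le> S"
    using a(1) by (simp add: mult.assoc [symmetric])
  have pt: "p \<le> \<tau> * p" using tau p by simp
  have up: "(\<Sum>j\<in>J. m j * y j) \<le> S + (1/2 + \<epsilon>) * (\<tau> * p)"
    unfolding S_def using weighted_sum_bounds(2) [OF J a(1,2) m y p pt] .
  have lo: "S + (1/2 - \<epsilon>) * p \<le> (\<Sum>j\<in>J. n j * y j)"
    unfolding S_def using weighted_sum_bounds(1) [OF J a(1,3) n y p pt] .
  \<comment> \<open>The claimed comparison of the two bounds is linear in \<open>S\<close>, an equality at \<open>S = p/2\<close>, with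
    nonnegative slope: the product below is the difference of its two sides.\<close>
  have "0 \<le> (S - p/2) * ((1/2 + \<epsilon>) * (\<tau> - 1) + 2 * \<epsilon>)"
    using S tau eps0 by (intro mult_nonneg_nonneg add_nonneg_nonneg) auto
  then have "(1 - \<epsilon>) * (S + (1/2 + \<epsilon>) * (\<tau> * p)) \<le> (1/2 + (1/2 + \<epsilon>) * \<tau>) * (S + (1/2 - \<epsilon>) * p)"
    by (simp add: field_simps)
  moreover have "(1 - \<epsilon>) * (\<Sum>j\<in>J. m j * y j) \<le> (1 - \<epsilon>) * (S + (1/2 + \<epsilon>) * (\<tau> * p))"
    using up eps by (intro mult_left_mono) auto
  moreover have "(1/2 + (1/2 + \<epsilon>) * \<tau>) * (S + (1/2 - \<epsilon>) * p) \<le> (1/2 + (1/2 + \<epsilon>) * \<tau>) * (\<Sum>j\<in>J. n j * y j)"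
    using lo tau eps0 by (intro mult_left_mono) auto
  ultimately show ?thesis by linarith
qed

text \<open>
  The contraction step of the scaling argument: taking reciprocals exchanges maximum and minimum, so
  the ratio of \<open>x\<close> is that of the image \<open>M y\<close>.
\<close>

lemma reciprocal_image_ratio:
  fixes M :: "'a \<Rightarrow> 'b \<Rightarrow> real" and a :: real
  assumes I: "finite I" "I \<noteq> {}" and J: "finite J" "J \<noteq> {}"
    and a: "a * card J = 1/2" "\<And>i j. i \<in> I \<Longrightarrow> j \<in> J \<Longrightarrow> a \<le> M i j"
    and M: "\<And>i. i \<in> I \<Longrightarrow> \<bar>(\<Sum>j\<in>J. M i j) - 1\<bar> \<le> \<epsilon>"
    and x: "\<And>i. i \<in> I \<Longrightarrow> 0 < x i" and y: "\<And>j. j \<in> J \<Longrightarrow> 0 < y j"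
    and eq: "\<And>i. i \<in> I \<Longrightarrow> x i * (\<Sum>j\<in>J. M i j * y j) = 1"
    and eps: "\<epsilon> \<le> 1/2"
  shows "(1 - \<epsilon>) * (Max (x ` I) / Min (x ` I)) \<le> 1/2 + (1/2 + \<epsilon>) * (Max (y ` J) / Min (y ` J))"
proof -
  obtain i where i: "i \<in> I" "Min (x ` I) = x i"
    using imageE [OF Min_in [of "x ` I"]] I by blast
  obtain k where k: "k \<in> I" "Max (x ` I) = x k"
    using imageE [OF Max_in [of "x ` I"]] I by blast
  obtain l where l: "l \<in> J" "Min (y ` J) = y l"
    using imageE [OF Min_in [of "y ` J"]] J by blast
  define p t where "p = Min (y ` J)" and "t = Max (y ` J)"
  have p: "0 < p" using y l by (simp add: p_def)
  have "p \<le> y j" "y j \<le> t" if "j \<in> J" for j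
    using that J(1) by (auto simp: p_def t_def)
  then have yb: "p \<le> y j" "y j \<le> t / p * p" and tau: "1 \<le> t / p" if "j \<in> J" for j
    using that p by (auto intro: order_trans)
  define C where "C = 1/2 + (1/2 + \<epsilon>) * (t / p)"
  have pos: "0 < x i" "0 < x k" using x i k by auto
  have w: "(\<Sum>j\<in>J. M i j * y j) = inverse (x i)" "(\<Sum>j\<in>J. M k j * y j) = inverse (x k)"
    using inverse_unique [OF eq [OF i(1)]] inverse_unique [OF eq [OF k(1)]] by simp_all
  have "(1 - \<epsilon>) * (\<Sum>j\<in>J. M i j * y j) \<le> C * (\<Sum>j\<in>J. M k j * y j)"
    unfolding C_def
    by (rule weighted_sums_ratio [OF J(1) a(1) a(2) [OF i(1)] a(2) [OF k(1)] M [OF i(1)] M [OF k(1)] yb p tau [OF l(1)] eps])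
  then have "x k * ((1 - \<epsilon>) * inverse (x i)) \<le> x k * (C * inverse (x k))"
    unfolding w using pos by (intro mult_left_mono) auto
  then have "(1 - \<epsilon>) * (x k / x i) \<le> C"
    using pos by (simp add: field_simps)
  then show ?thesis unfolding C_def p_def t_def i(2) k(2) .
qed

text \<open>
  Each hypothesis bounds one ratio by roughly the midpoint of 1 and the other; applied to the larger
  ratio, it bounds that ratio by itself with factor 1/2, and the resulting inequality can be solved.
\<close>

lemma scaling_ratio_bound:
  fixes \<rho> \<sigma> \<epsilon> :: real
  assumes "(1 - \<epsilon>) * \<rho> \<le> 1/2 + (1/2 + \<epsilon>) * \<sigma>" "(1 - \<epsilon>) * \<sigma> \<le> 1/2 + (1/2 + \<epsilon>) * \<rho>"
    and "0 \<le> \<epsilon>" "\<epsilon> \<le> 1/4"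
  shows "(1 - 4 * \<epsilon>) * \<sigma> \<le> 1"
proof (cases "\<rho> \<le> \<sigma>")
  case True
  then have "(1/2 + \<epsilon>) * \<rho> \<le> (1/2 + \<epsilon>) * \<sigma>"
    using assms by (intro mult_left_mono) auto
  then show ?thesis using assms(2) by (simp add: algebra_simps)
next
  case False
  then have "(1/2 + \<epsilon>) * \<sigma> \<le> (1/2 + \<epsilon>) * \<rho>"
    using assms by (intro mult_left_mono) auto
  then have "(1 - 4 * \<epsilon>) * \<rho> \<le> 1" using assms(1) by (simp add: algebra_simps)
  moreover have "(1 - 4 * \<epsilon>) * \<sigma> \<le> (1 - 4 * \<epsilon>) * \<rho>"
    using assms False by (intro mult_left_mono) auto
  ultimately show ?thesis by linarith
qed

text \<open>
  With \<open>y\<close> constant up to the factor \<open>1 / (1 - 4 \<epsilon>)\<close> and row sums within \<open>\<epsilon>\<close> of 1, the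
  sum \<open>w\<close> in \<open>x i * w = 1\<close> differs from any entry of \<open>y\<close> only by factors near 1. That yields
  \<open>(1 - 4 \<epsilon>) / (1 + \<epsilon>) \<le> x i * y j \<le> 1 / ((1 - \<epsilon>) (1 - 4 \<epsilon>))\<close>, and for \<open>\<epsilon> \<le> 1/48\<close> both
  bounds lie within \<open>6 \<epsilon>\<close> of 1.
\<close>

lemma scaling_products_near_one:
  fixes M :: "'a \<Rightarrow> 'b \<Rightarrow> real"
  assumes I: "finite I" "card I = q" and J: "finite J" "card J = q" and q: "0 < q"
    and M: "\<And>i j. i \<in> I \<Longrightarrow> j \<in> J \<Longrightarrow> 1 / (2 * real q) \<le> M i j"
    and row: "\<And>i. i \<in> I \<Longrightarrow> \<bar>(\<Sum>j\<in>J. M i j) - 1\<bar> \<le> \<epsilon>"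
    and col: "\<And>j. j \<in> J \<Longrightarrow> \<bar>(\<Sum>i\<in>I. M i j) - 1\<bar> \<le> \<epsilon>"
    and x: "\<And>i. i \<in> I \<Longrightarrow> 0 < x i" and y: "\<And>j. j \<in> J \<Longrightarrow> 0 < y j"
    and scaled_row: "\<And>i. i \<in> I \<Longrightarrow> x i * (\<Sum>j\<in>J. M i j * y j) = 1"
    and scaled_col: "\<And>j. j \<in> J \<Longrightarrow> y j * (\<Sum>i\<in>I. M i j * x i) = 1"
    and eps: "\<epsilon> \<le> 1/48"
    and i: "i \<in> I" and j: "j \<in> J"
  shows "\<bar>x i * y j - 1\<bar> \<le> 6 * \<epsilon>"
proof -
  let ?p = "Min (y ` J)" and ?t = "Max (y ` J)"
  have ne: "I \<noteq> {}" "J \<noteq> {}" using i j by auto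
  have eps0: "0 \<le> \<epsilon>" using row [OF i] by linarith
  have aI: "1 / (2 * real q) * card I = 1/2" and aJ: "1 / (2 * real q) * card J = 1/2"
    using I J q by auto
  have p: "0 < ?p" using y J ne by simp
  have yb: "?p \<le> y k" "y k \<le> ?t" if "k \<in> J" for k using that J by auto
  \<comment> \<open>The contraction step from \<open>y\<close> to \<open>x\<close> uses the rows of \<open>M\<close>, the one from \<open>x\<close> to \<open>y\<close> its columns.\<close>
  have "(1 - 4 * \<epsilon>) * (?t / ?p) \<le> 1"
  proof (rule scaling_ratio_bound)
    show "(1 - \<epsilon>) * (Max (x ` I) / Min (x ` I)) \<le> 1/2 + (1/2 + \<epsilon>) * (?t / ?p)"
      by (rule reciprocal_image_ratio [OF I(1) ne(1) J(1) ne(2) aJ M row x y scaled_row]) (use eps in auto)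
    show "(1 - \<epsilon>) * (?t / ?p) \<le> 1/2 + (1/2 + \<epsilon>) * (Max (x ` I) / Min (x ` I))"
      by (rule reciprocal_image_ratio [where M = "\<lambda>j i. M i j", OF J(1) ne(2) I(1) ne(1) aI M col y x scaled_col])
        (use eps in auto)
  qed (use eps eps0 in auto)
  then have tp: "(1 - 4 * \<epsilon>) * ?t \<le> ?p" using p by (simp add: field_simps)
  let ?w = "\<Sum>k\<in>J. M i k * y k"
  have Mpos: "0 \<le> M i k" if "k \<in> J" for k
    using M [OF i that] by (meson order_trans divide_nonneg_nonneg mult_nonneg_nonneg of_nat_0_le_iff zero_le_numeral zero_le_one)
  have "?w \<le> (\<Sum>k\<in>J. M i k) * ?t"
    unfolding sum_distrib_right using Mpos yb by (intro sum_mono mult_left_mono) auto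
  also have "\<dots> \<le> (1 + \<epsilon>) * ?t"
    using row [OF i] p yb [OF j] by (intro mult_right_mono) auto
  finally have w_up: "?w \<le> (1 + \<epsilon>) * ?t" .
  have "(1 - \<epsilon>) * ?p \<le> (\<Sum>k\<in>J. M i k) * ?p"
    using row [OF i] p by (intro mult_right_mono) auto
  also have "\<dots> \<le> ?w"
    unfolding sum_distrib_right using Mpos yb by (intro sum_mono mult_left_mono) auto
  finally have w_lo: "(1 - \<epsilon>) * ?p \<le> ?w" .
  have xw: "x i * ?w = 1" using scaled_row [OF i] .
  have xpos: "0 < x i" using x i by simp
  have t_pos: "0 < ?t" using p yb [OF j] by linarith
  have "(1 - \<epsilon>) * ((1 - 4 * \<epsilon>) * y j) \<le> (1 - \<epsilon>) * ((1 - 4 * \<epsilon>) * ?t)"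
    using yb [OF j] eps by (intro mult_left_mono) auto
  also have "\<dots> \<le> (1 - \<epsilon>) * ?p"
    using tp eps by (intro mult_left_mono) auto
  finally have "(1 - \<epsilon>) * ((1 - 4 * \<epsilon>) * y j) \<le> ?w" using w_lo by linarith
  then have "x i * ((1 - \<epsilon>) * ((1 - 4 * \<epsilon>) * y j)) \<le> 1"
    using mult_left_mono [OF _ less_imp_le [OF xpos]] xw by metis
  then have up: "((1 - \<epsilon>) * (1 - 4 * \<epsilon>)) * (x i * y j) \<le> 1" by (simp add: mult_ac)
  have "(1 - 4 * \<epsilon>) * ?w \<le> (1 - 4 * \<epsilon>) * ((1 + \<epsilon>) * ?t)"
    using w_up eps by (intro mult_left_mono) auto
  also have "\<dots> = (1 + \<epsilon>) * ((1 - 4 * \<epsilon>) * ?t)" by (simp add: mult_ac)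
  also have "\<dots> \<le> (1 + \<epsilon>) * y j"
    using tp yb [OF j] eps0 by (intro mult_left_mono) auto
  finally have "x i * ((1 - 4 * \<epsilon>) * ?w) \<le> x i * ((1 + \<epsilon>) * y j)"
    using xpos by simp
  then have "(1 - 4 * \<epsilon>) * (x i * ?w) \<le> (1 + \<epsilon>) * (x i * y j)"
    by (simp only: mult.left_commute)
  then have lo: "1 - 4 * \<epsilon> \<le> (1 + \<epsilon>) * (x i * y j)"
    using xw by simp
  have e2: "\<epsilon> * \<epsilon> \<le> \<epsilon> * (1/48)" using eps eps0 by (intro mult_left_mono) auto
  have "1 \<le> (1 - \<epsilon>) * (1 - 4 * \<epsilon>) * (1 + 6 * \<epsilon>)"
  proof -
    have "(1 - \<epsilon>) * (1 - 4 * \<epsilon>) * (1 + 6 * \<epsilon>) = 1 + \<epsilon> - 26 * (\<epsilon> * \<epsilon>) + 24 * (\<epsilon> * \<epsilon>) * \<epsilon>"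
      by (simp add: algebra_simps)
    moreover have "0 \<le> (\<epsilon> * \<epsilon>) * \<epsilon>" using eps0 by simp
    ultimately show ?thesis using e2 eps0 by linarith
  qed
  with up have "((1 - \<epsilon>) * (1 - 4 * \<epsilon>)) * (x i * y j) \<le> ((1 - \<epsilon>) * (1 - 4 * \<epsilon>)) * (1 + 6 * \<epsilon>)"
    by linarith
  moreover have "0 < (1 - \<epsilon>) * (1 - 4 * \<epsilon>)" using eps by (intro mult_pos_pos) auto
  ultimately have "x i * y j \<le> 1 + 6 * \<epsilon>" by (rule mult_left_le_imp_le)
  moreover have "(1 + \<epsilon>) * (1 - 6 * \<epsilon>) \<le> (1 + \<epsilon>) * (x i * y j)"
  proof -
    have "(1 + \<epsilon>) * (1 - 6 * \<epsilon>) = 1 - 5 * \<epsilon> - 6 * (\<epsilon> * \<epsilon>)" by (simp add: algebra_simps)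
    moreover have "0 \<le> \<epsilon> * \<epsilon>" by simp
    ultimately show ?thesis using lo eps0 by linarith
  qed
  then have "1 - 6 * \<epsilon> \<le> x i * y j" by (rule mult_left_le_imp_le) (use eps0 in simp)
  ultimately show ?thesis by linarith
qed

section \<open>Orthonormal eigenbases of symmetric matrices\<close>

text \<open>
  The cardinality is what makes the orthonormal set \<open>B\<close> a basis. The eigenvalue function \<open>l\<close> is an
  argument so that one set can serve several matrices, such as \<open>A\<close>, \<open>A ** A\<close> and \<open>mat 1\<close>.
\<close>

definition orthonormal_eigenbasis :: "real^'n^'n \<Rightarrow> (real^'n) set \<Rightarrow> (real^'n \<Rightarrow> real) \<Rightarrow> bool" where
  "orthonormal_eigenbasis A B l \<longleftrightarrow>
     finite B \<and> card B = CARD('n) \<and> pairwise orthogonal B \<and>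
     (\<forall>b\<in>B. norm b = 1 \<and> A *v b = l b *\<^sub>R b)"

lemma symmetric_inner:
  fixes A :: "real^'n^'n"
  assumes "A \<in> sym_mats"
  shows "(A *v x) \<bullet> y = x \<bullet> (A *v y)"
proof -
  have "A *v x = x v* A"
    using assms vector_transpose_matrix [of x A] by (simp add: sym_mats_def)
  then show ?thesis by (simp add: dot_lmul_matrix)
qed

lemma orthonormal_span_UNIV:
  fixes B :: "(real^'n) set"
  assumes "pairwise orthogonal B" "\<And>b. b \<in> B \<Longrightarrow> norm b = 1"
  shows "card B = CARD('n) \<longleftrightarrow> span B = UNIV" and "finite B"
proof -
  have ind: "independent B"
    using assms by (intro pairwise_orthogonal_independent) force+
  then show "finite B" by (rule independent_imp_finite)
  show "card B = CARD('n) \<longleftrightarrow> span B = UNIV"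
    using ind dim_eq_card_independent [OF ind] dim_eq_full [of B] by simp
qed

lemma orthonormal_eigenbasis_inner:
  assumes "orthonormal_eigenbasis A B l" "b \<in> B" "c \<in> B"
  shows "b \<bullet> c = (if b = c then 1 else 0)"
  using assms by (auto simp: orthonormal_eigenbasis_def pairwise_def orthogonal_def norm_eq_1)

lemma orthonormal_eigenbasis_expand:
  assumes "orthonormal_eigenbasis A B l"
  shows "(\<Sum>b\<in>B. (x \<bullet> b) *\<^sub>R b) = x"
  using assms orthonormal_span_UNIV(1) [of B]
  by (intro orthonormal_basis_expand) (auto simp: orthonormal_eigenbasis_def)

text \<open>
  A maximiser of the quadratic form on the unit sphere of the subspace is an eigenvector, by the
  first variation: moving from \<open>u\<close> in the direction of the residual \<open>w = A u - l u\<close> increases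
  the form minus \<open>l\<close> times the squared norm, which is at most 0 on the subspace and 0 at \<open>u\<close>,
  at the rate \<open>2 (w \<bullet> w)\<close>.
\<close>

lemma symmetric_eigenvector_in_subspace:
  fixes A :: "real^'n^'n"
  assumes A: "A \<in> sym_mats" and S: "subspace S" "S \<noteq> {0}" and inv: "\<And>x. x \<in> S \<Longrightarrow> A *v x \<in> S"
  obtains u l where "u \<in> S" "norm u = 1" "A *v u = l *\<^sub>R u"
proof -
  let ?K = "S \<inter> sphere 0 1"
  have "compact ?K"
    using S by (simp add: closed_subspace closed_Int_compact)
  moreover obtain x where x: "x \<in> S" "x \<noteq> 0"
    using S subspace_0 by blast
  then have "(1 / norm x) *\<^sub>R x \<in> ?K"
    using S by (simp add: subspace_scale)
  then have "?K \<noteq> {}" by blast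
  moreover have "continuous_on ?K (\<lambda>x. x \<bullet> (A *v x))"
    by (intro continuous_intros matrix_vector_mult_linear_continuous_on)
  ultimately obtain u where u: "u \<in> ?K" and max: "\<And>w. w \<in> ?K \<Longrightarrow> w \<bullet> (A *v w) \<le> u \<bullet> (A *v u)"
    using continuous_attains_sup [of ?K "\<lambda>x. x \<bullet> (A *v x)"] by blast
  define l where "l = u \<bullet> (A *v u)"
  have uS: "u \<in> S" and uu: "u \<bullet> u = 1" using u by (auto simp: norm_eq_1)
  have le: "w \<bullet> (A *v w) \<le> l * (w \<bullet> w)" if "w \<in> S" for w
  proof (cases "w = 0")
    case False
    then have "(1 / norm w) *\<^sub>R w \<in> ?K" using that S by (simp add: subspace_scale)
    from max [OF this] False show ?thesis
      by (simp add: l_def matrix_vector_mult_scaleR field_simps power2_norm_eq_inner [symmetric] power2_eq_square)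
  qed simp
  define w where "w = A *v u - l *\<^sub>R u"
  have wS: "w \<in> S"
    unfolding w_def using inv uS S by (intro subspace_diff subspace_scale)
  define c where "c = l * (w \<bullet> w) - w \<bullet> (A *v w)"
  have "2 * t * (w \<bullet> w) \<le> t\<^sup>2 * c" for t
  proof -
    have "u + t *\<^sub>R w \<in> S" using uS wS S by (intro subspace_add subspace_scale)
    from le [OF this] have "l + t * (u \<bullet> (A *v w)) + t * (w \<bullet> (A *v u)) + t\<^sup>2 * (w \<bullet> (A *v w))
        \<le> l * (1 + 2 * t * (u \<bullet> w) + t\<^sup>2 * (w \<bullet> w))"
      by (simp add: l_def matrix_vector_mult_scaleR matrix_vector_right_distrib inner_add_left inner_add_right
          uu inner_commute [of w u] power2_eq_square algebra_simps)
    moreover have "u \<bullet> (A *v w) = w \<bullet> (A *v u)"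
      using symmetric_inner [OF A, of u w] by (simp add: inner_commute)
    moreover have "w \<bullet> (A *v u) = w \<bullet> w + l * (u \<bullet> w)"
      by (simp add: w_def inner_diff_left inner_diff_right inner_commute algebra_simps)
    ultimately show ?thesis by (simp add: c_def algebra_simps)
  qed
  \<comment> \<open>A step so short that the quadratic term cannot compensate the linear one.\<close>
  define t where "t = (w \<bullet> w) / (\<bar>c\<bar> + 1)"
  have "2 * t * (w \<bullet> w) \<le> t\<^sup>2 * c" by fact
  also have "\<dots> \<le> t\<^sup>2 * (\<bar>c\<bar> + 1)" by (intro mult_left_mono) auto
  also have "\<dots> = t * (w \<bullet> w)" by (simp add: t_def power2_eq_square)
  finally have "t * (w \<bullet> w) \<le> 0" by linarith
  moreover have "\<not> \<bar>c\<bar> + 1 \<le> 0" by linarith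
  ultimately have "(w \<bullet> w)\<^sup>2 \<le> 0"
    unfolding t_def by (simp add: power2_eq_square divide_le_0_iff)
  then have "w \<bullet> w = 0" by simp
  then have "A *v u = l *\<^sub>R u" by (simp add: w_def)
  then show thesis using that [of u l] u by auto
qed

text \<open>
  By symmetry of \<open>A\<close>, the part of an invariant subspace orthogonal to an eigenvector is again
  invariant, so an eigenvector can be split off and the dimension drops.
\<close>

lemma symmetric_invariant_subspace_eigenbasis:
  fixes A :: "real^'n^'n"
  assumes A: "A \<in> sym_mats" and S: "subspace S" and inv: "\<And>x. x \<in> S \<Longrightarrow> A *v x \<in> S"
  shows "\<exists>B. pairwise orthogonal B \<and> span B = S \<and> (\<forall>b\<in>B. norm b = 1 \<and> (\<exists>l. A *v b = l *\<^sub>R b))"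
  using S inv
proof (induction "dim S" arbitrary: S rule: less_induct)
  case less
  show ?case
  proof (cases "S = {0}")
    case True
    then show ?thesis by (intro exI [of _ "{}"]) auto
  next
    case False
    then obtain u l where u: "u \<in> S" "norm u = 1" "A *v u = l *\<^sub>R u"
      using symmetric_eigenvector_in_subspace [OF A less.prems(1) False less.prems(2)] by blast
    define S' where "S' = {x \<in> S. u \<bullet> x = 0}"
    have uu: "u \<bullet> u = 1" using u by (simp add: norm_eq_1)
    have sub': "subspace S'"
      using less.prems(1) by (auto simp: S'_def subspace_def inner_add_right)
    have "u \<notin> S'" using uu by (simp add: S'_def)
    moreover have "S' \<subseteq> S" by (auto simp: S'_def)
    ultimately have "S' \<subset> S" using u(1) by blast
    then have "dim S' < dim S"
      using sub' less.prems(1) dim_psubset [of S' S] by (metis span_eq_iff)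
    moreover have "A *v x \<in> S'" if "x \<in> S'" for x
      using that less.prems(2) symmetric_inner [OF A, of u x] u by (simp add: S'_def)
    ultimately obtain B where B: "pairwise orthogonal B" "span B = S'"
        "\<forall>b\<in>B. norm b = 1 \<and> (\<exists>l. A *v b = l *\<^sub>R b)"
      using less.hyps sub' by metis
    have "B \<subseteq> S'" using B span_superset by blast
    then have "pairwise orthogonal (insert u B)"
      using B(1) by (auto simp: pairwise_insert S'_def orthogonal_def inner_commute)
    moreover have "span (insert u B) = S"
    proof
      show "span (insert u B) \<subseteq> S"
        using \<open>B \<subseteq> S'\<close> u less.prems(1) by (intro span_minimal) (auto simp: S'_def)
      show "S \<subseteq> span (insert u B)"
      proof
        fix x assume "x \<in> S"
        then have "x - (u \<bullet> x) *\<^sub>R u \<in> S'"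
          using u less.prems(1) uu by (simp add: S'_def subspace_diff subspace_scale inner_diff_right)
        then show "x \<in> span (insert u B)"
          using B(2) span_breakdown_eq by blast
      qed
    qed
    ultimately show ?thesis using B(3) u by (intro exI [of _ "insert u B"]) auto
  qed
qed

lemma symmetric_orthonormal_eigenbasis:
  fixes A :: "real^'n^'n"
  assumes "A \<in> sym_mats"
  obtains B l where "orthonormal_eigenbasis A B l"
proof -
  obtain B where B: "pairwise orthogonal B" "span B = UNIV"
      "\<forall>b\<in>B. norm b = 1 \<and> (\<exists>l. A *v b = l *\<^sub>R b)"
    using symmetric_invariant_subspace_eigenbasis [OF assms subspace_UNIV] by auto
  then obtain l where "\<forall>b\<in>B. A *v b = l b *\<^sub>R b" by metis
  then have "orthonormal_eigenbasis A B l"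
    using B orthonormal_span_UNIV [of B] by (auto simp: orthonormal_eigenbasis_def)
  then show thesis by (rule that)
qed

text \<open>
  By Pythagoras, \<open>A\<close> scales the coordinates in the eigenbasis independently.
\<close>

lemma spectral_norm_le_eigenvalues:
  fixes A :: "real^'n^'n"
  assumes B: "orthonormal_eigenbasis A B l" and l: "\<And>b. b \<in> B \<Longrightarrow> \<bar>l b\<bar> \<le> c" and c: "0 \<le> c"
  shows "spectral_norm A \<le> c"
  unfolding spectral_norm_def
proof (rule onorm_bound [OF c])
  fix x :: "real^'n"
  have fin: "finite B" using B by (simp add: orthonormal_eigenbasis_def)
  have norm_sum: "(norm (\<Sum>b\<in>B. f b *\<^sub>R b))\<^sup>2 = (\<Sum>b\<in>B. (f b)\<^sup>2)" for f
    using B by (subst norm_sum_Pythagorean)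
      (auto simp: orthonormal_eigenbasis_def pairwise_def orthogonal_def)
  have x: "x = (\<Sum>b\<in>B. (x \<bullet> b) *\<^sub>R b)"
    using orthonormal_eigenbasis_expand [OF B] by simp
  have "A *v x = (\<Sum>b\<in>B. (x \<bullet> b) *\<^sub>R (A *v b))"
    by (subst x) (simp add: linear_sum [OF matrix_vector_mul_linear] matrix_vector_mult_scaleR)
  also have "\<dots> = (\<Sum>b\<in>B. (l b * (x \<bullet> b)) *\<^sub>R b)"
    using B by (intro sum.cong) (auto simp: orthonormal_eigenbasis_def mult.commute)
  finally have "(norm (A *v x))\<^sup>2 = (\<Sum>b\<in>B. (l b * (x \<bullet> b))\<^sup>2)"
    using norm_sum by simp
  also have "\<dots> \<le> (\<Sum>b\<in>B. c\<^sup>2 * (x \<bullet> b)\<^sup>2)"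
    unfolding power_mult_distrib using l c by (intro sum_mono mult_right_mono) (auto simp: abs_le_square_iff [symmetric])
  also have "\<dots> = (c * norm x)\<^sup>2"
    using norm_sum [of "\<lambda>b. x \<bullet> b"] x by (simp add: sum_distrib_left [symmetric] power_mult_distrib)
  finally show "norm (A *v x) \<le> c * norm x"
    using c by (meson mult_nonneg_nonneg norm_ge_zero power2_le_imp_le)
qed

lemma orthonormal_eigenbasis_shift:
  assumes "orthonormal_eigenbasis A B l"
  shows "orthonormal_eigenbasis (A - mat 1) B (\<lambda>b. l b - 1)"
  using assms by (auto simp: orthonormal_eigenbasis_def matrix_vector_mult_diff_rdistrib scaleR_left_diff_distrib)

lemma orthonormal_eigenbasis_square:
  assumes "orthonormal_eigenbasis A B l"
  shows "orthonormal_eigenbasis (A ** A) B (\<lambda>b. (l b)\<^sup>2)"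
  using assms by (auto simp: orthonormal_eigenbasis_def matrix_vector_mul_assoc [symmetric]
      matrix_vector_mult_scaleR power2_eq_square)

lemma orthonormal_eigenbasis_mat_1:
  assumes "orthonormal_eigenbasis A B l"
  shows "orthonormal_eigenbasis (mat 1) B (\<lambda>_. 1)"
  using assms by (auto simp: orthonormal_eigenbasis_def)

lemma posdef_eigenvalue_pos:
  assumes "posdef A" "orthonormal_eigenbasis A B l" "b \<in> B"
  shows "0 < l b"
proof -
  have b: "norm b = 1" "A *v b = l b *\<^sub>R b" using assms by (auto simp: orthonormal_eigenbasis_def)
  then have "0 < b \<bullet> (A *v b)" using assms(1) unfolding posdef_def by (metis norm_zero zero_neq_one)
  then show ?thesis using b by (simp add: norm_eq_1)
qed

section \<open>Rank-one matrices and spectral decompositions\<close>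

lemma outer_self_nth: "outer_self v $ i $ j = v $ i * v $ j"
  by (simp add: outer_self_def matrix_matrix_mult_def columnvector_def rowvector_def)

lemma outer_self_sym: "outer_self v \<in> sym_mats"
  by (simp add: sym_mats_def transpose_def vec_eq_iff outer_self_nth mult.commute)

lemma outer_self_mult_vec: "outer_self v *v x = (x \<bullet> v) *\<^sub>R v"
  by (simp add: vec_eq_iff matrix_vector_mult_def outer_self_nth inner_vec_def sum_distrib_left mult_ac)

lemma inner_outer_self: "outer_self v \<bullet> A = v \<bullet> (A *v v)"
  by (simp add: inner_vec_def matrix_vector_mult_def outer_self_nth sum_distrib_left mult_ac)

text \<open>
  Through this expansion, the value of a linear operator at any matrix diagonal in the basis \<open>B\<close> is a
  combination of its values at the rank-one matrices \<open>outer_self b\<close>.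
\<close>

lemma spectral_decomposition:
  assumes B: "orthonormal_eigenbasis A B l"
  shows "A = (\<Sum>b\<in>B. l b *\<^sub>R outer_self b)"
proof (subst matrix_eq, rule allI)
  fix x
  have lin: "linear (\<lambda>A::real^'a^'a. A *v x)"
    by (intro linearI) (auto simp: matrix_vector_mult_add_rdistrib scaleR_matrix_vector_assoc)
  have "A *v x = A *v (\<Sum>b\<in>B. (x \<bullet> b) *\<^sub>R b)"
    using orthonormal_eigenbasis_expand [OF B, of x] by simp
  also have "\<dots> = (\<Sum>b\<in>B. (x \<bullet> b) *\<^sub>R (A *v b))"
    by (simp add: linear_sum [OF matrix_vector_mul_linear] matrix_vector_mult_scaleR)
  also have "\<dots> = (\<Sum>b\<in>B. (l b *\<^sub>R outer_self b) *v x)"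
    using B by (intro sum.cong)
      (auto simp: orthonormal_eigenbasis_def outer_self_mult_vec scaleR_matrix_vector_assoc [symmetric] mult.commute)
  also have "\<dots> = (\<Sum>b\<in>B. l b *\<^sub>R outer_self b) *v x"
    by (simp add: linear_sum [OF lin])
  finally show "A *v x = (\<Sum>b\<in>B. l b *\<^sub>R outer_self b) *v x" .
qed

lemma inner_mat_1:
  assumes "orthonormal_eigenbasis A B l"
  shows "Z \<bullet> mat 1 = (\<Sum>b\<in>B. outer_self b \<bullet> Z)"
  by (subst spectral_decomposition [OF orthonormal_eigenbasis_mat_1 [OF assms]])
    (simp add: inner_sum_right inner_commute)

lemma spectral_norm_quadratic_form:
  fixes A :: "real^'n^'n"
  assumes "norm v = 1"
  shows "\<bar>outer_self v \<bullet> A\<bar> \<le> spectral_norm A"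
proof -
  have "\<bar>outer_self v \<bullet> A\<bar> \<le> norm v * norm (A *v v)"
    unfolding inner_outer_self by (rule Cauchy_Schwarz_ineq2)
  also have "\<dots> \<le> spectral_norm A"
    using onorm [OF matrix_vector_mul_bounded_linear, of A v] assms by (simp add: spectral_norm_def)
  finally show ?thesis .
qed

section \<open>Eigenvalues of a Kronecker product\<close>

definition kronecker_vec :: "real^'m \<Rightarrow> real^'n \<Rightarrow> real^('m \<times> 'n)" where
  "kronecker_vec v u = (\<chi> p. v $ fst p * u $ snd p)"

lemma inner_kronecker_vec: "kronecker_vec v u \<bullet> kronecker_vec v' u' = (v \<bullet> v') * (u \<bullet> u')"
proof -
  have "kronecker_vec v u \<bullet> kronecker_vec v' u' = (\<Sum>p\<in>UNIV \<times> UNIV. (v $ fst p * v' $ fst p) * (u $ snd p * u' $ snd p))"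
    by (simp add: kronecker_vec_def inner_vec_def mult_ac)
  also have "\<dots> = (v \<bullet> v') * (u \<bullet> u')"
    by (simp add: inner_vec_def sum_product sum.cartesian_product split_def)
  finally show ?thesis .
qed

lemma kronecker_mult_vec: "kronecker A B *v kronecker_vec v u = kronecker_vec (A *v v) (B *v u)"
proof (subst vec_eq_iff, rule allI)
  fix p :: "'a \<times> 'b"
  have "(kronecker A B *v kronecker_vec v u) $ p =
      (\<Sum>r\<in>UNIV \<times> UNIV. (A $ fst p $ fst r * v $ fst r) * (B $ snd p $ snd r * u $ snd r))"
    by (simp add: kronecker_vec_def kronecker_def matrix_vector_mult_def mult_ac)
  also have "\<dots> = kronecker_vec (A *v v) (B *v u) $ p"
    by (simp add: kronecker_vec_def matrix_vector_mult_def sum_product sum.cartesian_product split_def)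
  finally show "(kronecker A B *v kronecker_vec v u) $ p = kronecker_vec (A *v v) (B *v u) $ p" .
qed

lemma kronecker_vec_scaleR: "kronecker_vec (a *\<^sub>R v) (b *\<^sub>R u) = (a * b) *\<^sub>R kronecker_vec v u"
  by (simp add: kronecker_vec_def vec_eq_iff mult_ac)

text \<open>
  The vectors \<open>v \<otimes> u\<close> form an orthonormal eigenbasis of the Kronecker product, with eigenvalues
  \<open>\<mu> v * l u\<close>.
\<close>

lemma spectral_norm_kronecker_diff_le:
  fixes A :: "real^'m^'m" and B :: "real^'n^'n"
  assumes A: "orthonormal_eigenbasis A V \<mu>" and B: "orthonormal_eigenbasis B U l"
    and c: "\<And>v u. v \<in> V \<Longrightarrow> u \<in> U \<Longrightarrow> \<bar>\<mu> v * l u - 1\<bar> \<le> c"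
  shows "spectral_norm (kronecker A B - mat 1) \<le> c"
proof -
  let ?k = "\<lambda>(v, u). kronecker_vec v u"
  define W where "W = ?k ` (V \<times> U)"
  \<comment> \<open>The eigenvalue as a function of the product vector alone, without choosing its factors.\<close>
  define \<nu> where "\<nu> w = w \<bullet> (kronecker A B *v w)" for w
  have ip: "?k p \<bullet> ?k r = (if p = r then 1 else 0)" if "p \<in> V \<times> U" "r \<in> V \<times> U" for p r
    using that
    by (auto simp: inner_kronecker_vec orthonormal_eigenbasis_inner [OF A] orthonormal_eigenbasis_inner [OF B]
        split: if_splits)
  have inj: "inj_on ?k (V \<times> U)"
  proof (rule inj_onI)
    fix p r assume *: "p \<in> V \<times> U" "r \<in> V \<times> U" "?k p = ?k r"
    then show "p = r" using ip [of p r] ip [of p p] by (metis zero_neq_one)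
  qed
  have eig: "kronecker A B *v kronecker_vec v u = (\<mu> v * l u) *\<^sub>R kronecker_vec v u" if "v \<in> V" "u \<in> U" for v u
    using that A B by (simp add: orthonormal_eigenbasis_def kronecker_mult_vec kronecker_vec_scaleR)
  have nu: "\<nu> (kronecker_vec v u) = \<mu> v * l u" if "v \<in> V" "u \<in> U" for v u
    using ip [of "(v, u)" "(v, u)"] that by (simp add: \<nu>_def eig)
  have K: "orthonormal_eigenbasis (kronecker A B) W \<nu>"
    unfolding orthonormal_eigenbasis_def
  proof (intro conjI ballI)
    show "finite W" using A B by (auto simp: W_def orthonormal_eigenbasis_def)
    show "card W = CARD('m \<times> 'n)"
      unfolding W_def card_image [OF inj] using A B by (simp add: card_cartesian_product orthonormal_eigenbasis_def)
    show "pairwise orthogonal W"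
      unfolding W_def pairwise_def orthogonal_def using ip by (smt (verit) imageE)
    show "norm w = 1" "kronecker A B *v w = \<nu> w *\<^sub>R w" if "w \<in> W" for w
      using that ip eig nu by (auto simp: W_def norm_eq_1)
  qed
  have ne: "V \<noteq> {}" "U \<noteq> {}" using A B by (auto simp: orthonormal_eigenbasis_def)
  then have "0 \<le> c" using c by (meson abs_ge_zero ex_in_conv order_trans)
  moreover have "\<bar>\<nu> w - 1\<bar> \<le> c" if "w \<in> W" for w
    using that c nu by (auto simp: W_def)
  ultimately show ?thesis
    by (intro spectral_norm_le_eigenvalues [OF orthonormal_eigenbasis_shift [OF K]])
qed

section \<open>Operators on symmetric matrices\<close>

text \<open>
  Linearity is available only on symmetric matrices, so the partial sums have to be kept symmetric
  along the induction.
\<close>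

lemma sym_operator_sum:
  assumes T: "sym_operator T" and "finite B" and X: "\<And>b. b \<in> B \<Longrightarrow> X b \<in> sym_mats"
  shows "T (\<Sum>b\<in>B. c b *\<^sub>R X b) = (\<Sum>b\<in>B. c b *\<^sub>R T (X b))"
proof -
  have add: "P + Q \<in> sym_mats" if "P \<in> sym_mats" "Q \<in> sym_mats" for P Q :: "real^'a^'a"
    using that by (simp add: sym_mats_def transpose_def vec_eq_iff)
  have scale: "r *\<^sub>R P \<in> sym_mats" if "P \<in> sym_mats" for r and P :: "real^'a^'a"
    using that by (simp add: sym_mats_def transpose_def vec_eq_iff)
  have zero: "(0 :: real^'a^'a) \<in> sym_mats"
    by (simp add: sym_mats_def transpose_def vec_eq_iff)
  have T0: "T 0 = 0"
    using T zero unfolding sym_operator_def by (metis scaleR_zero_left)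
  have "(\<Sum>b\<in>B. c b *\<^sub>R X b) \<in> sym_mats \<and> T (\<Sum>b\<in>B. c b *\<^sub>R X b) = (\<Sum>b\<in>B. c b *\<^sub>R T (X b))"
    using \<open>finite B\<close> X
  proof (induction B)
    case empty
    then show ?case by (simp add: zero T0)
  next
    case (insert b B)
    then have "X b \<in> sym_mats" "(\<Sum>b\<in>B. c b *\<^sub>R X b) \<in> sym_mats" by auto
    then show ?case
      using T insert add scale by (simp add: sym_operator_def)
  qed
  then show ?thesis ..
qed

lemma sym_adjoint_inner:
  assumes "sym_operator T" "X \<in> sym_mats"
  shows "T X \<bullet> Y = X \<bullet> sym_adjoint T Y"
  using theI' [OF sym_adjoint_unique_existence [OF assms(1), of Y]] assms(2)
  by (simp add: sym_adjoint_def)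

lemma inner_outer_self_conj_op:
  assumes "N \<in> sym_mats" "N *v v = c *\<^sub>R v"
  shows "outer_self v \<bullet> conj_op N Z = c\<^sup>2 * (outer_self v \<bullet> Z)"
  using assms
  by (simp add: inner_outer_self conj_op_def matrix_vector_mul_assoc [symmetric]
      symmetric_inner [OF assms(1), symmetric] matrix_vector_mult_scaleR power2_eq_square)

lemma conj_op_outer_self:
  assumes "N \<in> sym_mats" "N *v v = c *\<^sub>R v"
  shows "conj_op N (outer_self v) = c\<^sup>2 *\<^sub>R outer_self v"
proof (subst matrix_eq, rule allI)
  fix x
  have "conj_op N (outer_self v) *v x = ((N *v x) \<bullet> v) *\<^sub>R (N *v v)"
    by (simp add: conj_op_def matrix_vector_mul_assoc [symmetric] outer_self_mult_vec matrix_vector_mult_scaleR)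
  also have "\<dots> = (c\<^sup>2 *\<^sub>R outer_self v) *v x"
    by (simp add: symmetric_inner [OF assms(1)] assms(2) outer_self_mult_vec
        scaleR_matrix_vector_assoc [symmetric] power2_eq_square)
  finally show "conj_op N (outer_self v) *v x = (c\<^sup>2 *\<^sub>R outer_self v) *v x" .
qed

text \<open>
  The reduction to matrix scaling. The condition \<open>S (mat 1) = mat 1\<close> on the scaled operator \<open>S\<close>,
  tested against \<open>v v'\<close>, is the scaled row equation; the adjoint condition, tested against
  \<open>u u'\<close>, is the scaled column equation.
\<close>

lemma scaled_eigenvalue_products_near_one:
  fixes T :: "real^'q^'q \<Rightarrow> real^'q^'q" and N1 N2 :: "real^'q^'q"
  assumes T: "sym_operator T"
    and lower: "\<And>u v :: real^'q. norm u = 1 \<Longrightarrow> norm v = 1 \<Longrightarrow> 1 / (2 * real CARD('q)) \<le> outer_self v \<bullet> T (outer_self u)"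
    and row: "spectral_norm (T (mat 1) - mat 1) \<le> \<epsilon>"
    and col: "spectral_norm (sym_adjoint T (mat 1) - mat 1) \<le> \<epsilon>"
    and eps: "\<epsilon> \<le> 1/48"
    and pd: "posdef N1" "posdef N2"
    and ds: "doubly_stochastic (conj_op N2 \<circ> T \<circ> conj_op N1)"
    and U: "orthonormal_eigenbasis N1 U l" and V: "orthonormal_eigenbasis N2 V \<mu>"
    and v: "v \<in> V" and u: "u \<in> U"
  shows "\<bar>(\<mu> v)\<^sup>2 * (l u)\<^sup>2 - 1\<bar> \<le> 6 * \<epsilon>"
proof -
  let ?S = "conj_op N2 \<circ> T \<circ> conj_op N1"
  let ?M = "\<lambda>v u. outer_self v \<bullet> T (outer_self u)"
  have N: "N1 \<in> sym_mats" "N2 \<in> sym_mats" using pd by (auto simp: posdef_def)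
  have finU: "finite U" "card U = CARD('q)" and finV: "finite V" "card V = CARD('q)"
    using U V by (auto simp: orthonormal_eigenbasis_def)
  have Ub: "norm u = 1" "N1 *v u = l u *\<^sub>R u" if "u \<in> U" for u
    using that U by (auto simp: orthonormal_eigenbasis_def)
  have Vb: "norm v = 1" "N2 *v v = \<mu> v *\<^sub>R v" if "v \<in> V" for v
    using that V by (auto simp: orthonormal_eigenbasis_def)
  have inner_1: "outer_self w \<bullet> mat 1 = 1" if "norm w = 1" for w :: "real^'q"
    using that by (simp add: inner_outer_self norm_eq_1)
  have T_sum: "outer_self v \<bullet> T A = (\<Sum>u\<in>U. ?M v u * a u)" if "orthonormal_eigenbasis A U a" for A v a
    by (subst spectral_decomposition [OF that])
      (simp add: sym_operator_sum [OF T finU(1) outer_self_sym] inner_sum_right mult.commute)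
  show ?thesis
  proof (rule scaling_products_near_one [where M = ?M and I = V and J = U and x = "\<lambda>v. (\<mu> v)\<^sup>2" and y = "\<lambda>u. (l u)\<^sup>2"
        and q = "CARD('q)"])
    fix v u assume "v \<in> V" "u \<in> U"
    then show "1 / (2 * real CARD('q)) \<le> ?M v u" using lower Ub Vb by blast
  next
    fix v assume v: "v \<in> V"
    have "(\<Sum>u\<in>U. ?M v u) = outer_self v \<bullet> T (mat 1)"
      using T_sum [OF orthonormal_eigenbasis_mat_1 [OF U]] by simp
    then have "(\<Sum>u\<in>U. ?M v u) - 1 = outer_self v \<bullet> (T (mat 1) - mat 1)"
      using inner_1 [OF Vb(1) [OF v]] by (simp add: inner_diff_right)
    then show "\<bar>(\<Sum>u\<in>U. ?M v u) - 1\<bar> \<le> \<epsilon>"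
      using spectral_norm_quadratic_form [OF Vb(1) [OF v]] row by (metis order_trans)
    have "?S (mat 1) = mat 1" using ds by (simp add: doubly_stochastic_def)
    then have "1 = outer_self v \<bullet> conj_op N2 (T (N1 ** N1))"
      using inner_1 [OF Vb(1) [OF v]] by (simp add: conj_op_def)
    also have "\<dots> = (\<mu> v)\<^sup>2 * (\<Sum>u\<in>U. ?M v u * (l u)\<^sup>2)"
      by (simp add: inner_outer_self_conj_op [OF N(2) Vb(2) [OF v]] T_sum [OF orthonormal_eigenbasis_square [OF U]])
    finally show "(\<mu> v)\<^sup>2 * (\<Sum>u\<in>U. ?M v u * (l u)\<^sup>2) = 1" by simp
    show "0 < (\<mu> v)\<^sup>2" using posdef_eigenvalue_pos [OF pd(2) V v] by simp
  next
    fix u assume u: "u \<in> U"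
    have "(\<Sum>v\<in>V. ?M v u) = outer_self u \<bullet> sym_adjoint T (mat 1)"
      using inner_mat_1 [OF V] sym_adjoint_inner [OF T outer_self_sym] by metis
    then have "(\<Sum>v\<in>V. ?M v u) - 1 = outer_self u \<bullet> (sym_adjoint T (mat 1) - mat 1)"
      using inner_1 [OF Ub(1) [OF u]] by (simp add: inner_diff_right)
    then show "\<bar>(\<Sum>v\<in>V. ?M v u) - 1\<bar> \<le> \<epsilon>"
      using spectral_norm_quadratic_form [OF Ub(1) [OF u]] col by (metis order_trans)
    have T_scale: "T (c *\<^sub>R outer_self u) = c *\<^sub>R T (outer_self u)" for c
      using T outer_self_sym unfolding sym_operator_def by blast
    have S: "sym_operator ?S" "sym_adjoint ?S (mat 1) = mat 1" using ds by (simp_all add: doubly_stochastic_def)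
    have "1 = ?S (outer_self u) \<bullet> mat 1"
      using sym_adjoint_inner [OF S(1) outer_self_sym, of u "mat 1"] S(2) inner_1 [OF Ub(1) [OF u]] by simp
    also have "\<dots> = (\<Sum>v\<in>V. outer_self v \<bullet> conj_op N2 ((l u)\<^sup>2 *\<^sub>R T (outer_self u)))"
      using inner_mat_1 [OF V, of "?S (outer_self u)"]
      by (simp add: conj_op_outer_self [OF N(1) Ub(2) [OF u]] T_scale)
    also have "\<dots> = (\<Sum>v\<in>V. (\<mu> v)\<^sup>2 * ((l u)\<^sup>2 * ?M v u))"
      by (intro sum.cong refl) (simp add: inner_outer_self_conj_op [OF N(2) Vb(2)])
    finally show "(l u)\<^sup>2 * (\<Sum>v\<in>V. ?M v u * (\<mu> v)\<^sup>2) = 1"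
      by (simp add: sum_distrib_left mult_ac)
    show "0 < (l u)\<^sup>2" using posdef_eigenvalue_pos [OF pd(1) U u] by simp
  qed (use finU finV eps u v in auto)
qed

theorem proposition19:
  fixes T :: "real^'q^'q \<Rightarrow> real^'q^'q"
    and N1 N2 :: "real^'q^'q"
    and \<epsilon> :: real
  assumes "sym_operator T" and "psd_preserving T" and "rank_indecomposable T"
    and "\<And>u v :: real^'q. norm u = 1 \<Longrightarrow> norm v = 1 \<Longrightarrow>
           \<bar>outer_self v \<bullet> T (outer_self u) - 1 / real CARD('q)\<bar> \<le> 1 / (2 * real CARD('q))"
    and "\<epsilon> = max (spectral_norm (T (mat 1) - mat 1)) (spectral_norm (sym_adjoint T (mat 1) - mat 1))"
    and "\<epsilon> \<le> 1 / (48 * sqrt (real CARD('q)))"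
    and "posdef N1" and "posdef N2"
    and "doubly_stochastic (conj_op N2 \<circ> T \<circ> conj_op N1)"
  shows "spectral_norm (kronecker (N2 ** N2) (N1 ** N1) - mat 1) \<le> 96 * sqrt (real CARD('q)) * \<epsilon>
    \<and> spectral_norm (kronecker N2 N1 - mat 1) \<le> 96 * sqrt (real CARD('q)) * \<epsilon>"
proof -
  have lower: "1 / (2 * real CARD('q)) \<le> outer_self v \<bullet> T (outer_self u)" if "norm u = 1" "norm v = 1" for u v :: "real^'q"
  proof -
    have "1 / real CARD('q) = 2 * (1 / (2 * real CARD('q)))" by simp
    then show ?thesis using assms(4) [OF that] by linarith
  qed
  have sq: "1 \<le> sqrt (real CARD('q))" by (simp add: Suc_le_eq)
  then have "1 / (48 * sqrt (real CARD('q))) \<le> 1 / 48" by (simp add: field_simps)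
  then have eps: "\<epsilon> \<le> 1/48" using assms(6) by linarith
  have sym: "N1 \<in> sym_mats" "N2 \<in> sym_mats"
    using assms(7,8) by (simp_all add: posdef_def)
  obtain U l where U: "orthonormal_eigenbasis N1 U l"
    by (rule symmetric_orthonormal_eigenbasis [OF sym(1)])
  obtain V \<mu> where V: "orthonormal_eigenbasis N2 V \<mu>"
    by (rule symmetric_orthonormal_eigenbasis [OF sym(2)])
  have row: "spectral_norm (T (mat 1) - mat 1) \<le> \<epsilon>"
    and col: "spectral_norm (sym_adjoint T (mat 1) - mat 1) \<le> \<epsilon>"
    using assms(5) by simp_all
  have squares: "\<bar>(\<mu> v)\<^sup>2 * (l u)\<^sup>2 - 1\<bar> \<le> 6 * \<epsilon>" if "v \<in> V" "u \<in> U" for v u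
    by (rule scaled_eigenvalue_products_near_one [OF assms(1) lower row col eps assms(7-9) U V that])
  have products: "\<bar>\<mu> v * l u - 1\<bar> \<le> 6 * \<epsilon>" if vu: "v \<in> V" "u \<in> U" for v u
  proof -
    have pos: "0 < \<mu> v * l u"
      using posdef_eigenvalue_pos [OF assms(8) V vu(1)] posdef_eigenvalue_pos [OF assms(7) U vu(2)] by simp
    have "\<bar>\<mu> v * l u - 1\<bar> * 1 \<le> \<bar>\<mu> v * l u - 1\<bar> * (\<mu> v * l u + 1)"
      using pos by (intro mult_left_mono) auto
    also have "\<dots> = \<bar>(\<mu> v * l u - 1) * (\<mu> v * l u + 1)\<bar>" using pos by (simp add: abs_mult)
    also have "\<dots> = \<bar>(\<mu> v)\<^sup>2 * (l u)\<^sup>2 - 1\<bar>" by (simp add: algebra_simps power2_eq_square)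
    finally show ?thesis using squares [OF vu] by simp
  qed
  have "spectral_norm (kronecker (N2 ** N2) (N1 ** N1) - mat 1) \<le> 6 * \<epsilon>"
    by (rule spectral_norm_kronecker_diff_le [OF orthonormal_eigenbasis_square [OF V] orthonormal_eigenbasis_square [OF U]])
      (rule squares)
  moreover have "spectral_norm (kronecker N2 N1 - mat 1) \<le> 6 * \<epsilon>"
    by (rule spectral_norm_kronecker_diff_le [OF V U]) (rule products)
  moreover have eps0: "0 \<le> \<epsilon>"
    using assms(5) onorm_pos_le [OF matrix_vector_mul_bounded_linear, of "T (mat 1) - mat 1"]
    by (simp add: spectral_norm_def le_max_iff_disj)
  have "6 \<le> 96 * sqrt (real CARD('q))" using sq by linarith
  then have "6 * \<epsilon> \<le> 96 * sqrt (real CARD('q)) * \<epsilon>"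
    using eps0 by (rule mult_right_mono)
  ultimately show ?thesis by linarith
qed

end
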